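(* Let $b>0$, $p>1$ and $q>1-\frac1p$ be constants, let $I=(0,1)$, and for $\lambda>0$ consider the problem $$-\left(\int_0^1 |u(x)|^p\,dx+b\right)^q u''(x) = \lambda u(x)^p \ \ (x\in I),\qquad u(x)>0\ \ (x\in I),\qquad u(0)=u(1)=0. \quad (P)$$ Then for all sufficiently large $\lambda$ the problem $(P)$ has exactly two solutions $u_{1,\lambda}$ and $u_{2,\lambda}$. Moreover, with a suitable labelling of the two solutions, as $\lambda\to\infty$, $$u_{1,\lambda}(x)=b^{q/(p-1)}\lambda^{-1/(p-1)}\left\{1+\frac{q}{p-1}b^{(pq-p+1)/(p-1)}\|W_p\|_p^p\,\lambda^{-p/(p-1)}(1+o(1))\right\}W_p(x),$$ $$u_{2,\lambda}(x)=\left\{m\lambda^{1/(pq-p+1)}-\frac{bq\,m^{1-p}}{pq-p+1}\lambda^{(1-p)/(pq-p+1)}(1+o(1))\right\}\|W_p\|_p^{-1}W_p(x),$$ where $m:=\|W_p\|_p^{(1-p)/(pq-p+1)}$.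
   Context: Solutions are classical: $u\in C^2(I)\cap C([0,1])$. For $p>1$, $W_p$ denotes the unique solution (existence and uniqueness are known) of $-W''(x)=W(x)^p$ for $x\in(0,1)$, $W(x)>0$ for $x\in(0,1)$, $W(0)=W(1)=0$. $\|u\|_p=\left(\int_0^1|u(x)|^pdx\right)^{1/p}$. The $o(1)$ terms are as $\lambda\to\infty$ and do not depend on $x$ (the solutions are scalar multiples of $W_p$). *)

theory Defs
  imports "HOL-Analysis.Analysis"
begin

(* C^2 on S; meant for open S, where the two-sided derivative deriv is the right notion. *)
definition C2_on :: "real set \<Rightarrow> (real \<Rightarrow> real) \<Rightarrow> bool" where
  "C2_on S u \<longleftrightarrow>
     u differentiable_on S \<and> deriv u differentiable_on S \<and> continuous_on S (deriv (deriv u))"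

(* The regularity class "C^2((0,1)) and C([0,1])".  A function on [0,1] is represented by the
   total function that is extensional on {0..1}, so that equality of such functions is equality
   on [0,1] and solutions can be counted. *)
definition classical :: "(real \<Rightarrow> real) \<Rightarrow> bool" where
  "classical u \<longleftrightarrow> u \<in> extensional {0..1} \<and> continuous_on {0..1} u \<and> C2_on {0<..<1} u"

definition Lp_norm :: "real \<Rightarrow> (real \<Rightarrow> real) \<Rightarrow> real" where
  "Lp_norm p u = (integral {0..1} (\<lambda>x. \<bar>u x\<bar> powr p)) powr (1 / p)"

definition W :: "real \<Rightarrow> real \<Rightarrow> real" where
  "W p = (THE w. classical w
            \<and> (\<forall>x\<in>{0<..<1}. - deriv (deriv w) x = w x powr p)
            \<and> (\<forall>x\<in>{0<..<1}. w x > 0)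
            \<and> w 0 = 0 \<and> w 1 = 0)"

definition solution :: "real \<Rightarrow> real \<Rightarrow> real \<Rightarrow> real \<Rightarrow> (real \<Rightarrow> real) \<Rightarrow> bool" where
  "solution b p q lam u \<longleftrightarrow> classical u
     \<and> (\<forall>x\<in>{0<..<1}.
          - ((integral {0..1} (\<lambda>y. \<bar>u y\<bar> powr p) + b) powr q) * deriv (deriv u) x
            = lam * u x powr p)
     \<and> (\<forall>x\<in>{0<..<1}. u x > 0)
     \<and> u 0 = 0 \<and> u 1 = 0"

end

(* Any solution u of (P) solves - K u'' = u^p with the constant K = (|u|_p^p + b)^q / lam, so it is
   c W_p for some c > 0, and c W_p solves (P) iff (N^p c^p + b)^q = lam c^(p-1), where N = |W_p|_p.
   The logarithm of (N^p c^p + b)^q c^(1-p) tends to infinity at 0 and at infinity and has exactly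
   one critical point, so for large lam there are two roots c, one tending to 0 and one to infinity;
   their expansions follow from (1 + y)^a = 1 + a y (1 + o(1)), with y = N^p c^p / b for the small
   root and y = b / (N^p c^p) for the large one.

   W_p comes from conservation of energy: if F(s) is the integral of (1 - t^(p+1))^(-1/2) over [0,s],
   a positive profile with maximum M at c satisfies F(u(x)/M) = k x on [0,c], where
   k = (2/(p+1))^(1/2) M^((p-1)/2). Comparing with the reflected profile gives c = 1/2 and k = 2 F(1),
   which determines M and hence u; inverting F conversely produces a profile. *)
theory Submission
  imports Defs
begin

section \<open>The boundary value problem for W\<close>

text \<open>The fundamental theorem of calculus tolerates one exceptional interior point, so
  \<open>u\<close> equals \<open>u a\<close> plus the integral of \<open>g\<close> on all of [a,b];
  since \<open>g\<close> is continuous, that integral is differentiable at \<open>c\<close> too.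
  This serves to glue two halves of a profile at the midpoint.\<close>

lemma has_real_derivative_exceptional_point:
  fixes u g :: "real \<Rightarrow> real"
  assumes "a < c" "c < b"
    and u: "continuous_on {a..b} u" and g: "continuous_on {a..b} g"
    and der: "\<And>x. x \<in> {a<..<b} - {c} \<Longrightarrow> (u has_real_derivative g x) (at x)"
  shows "(u has_real_derivative g c) (at c)"
proof -
  have int: "integral {a..x} g = u x - u a" if "x \<in> {a..b}" for x
  proof (rule integral_unique, rule fundamental_theorem_of_calculus_interior_strong[of "{c}"])
    show "continuous_on {a..x} u"
      using u that by (auto intro: continuous_on_subset)
    show "(u has_vector_derivative g y) (at y)" if "y \<in> {a<..<x} - {c}" for y
      using der[of y] that \<open>x \<in> {a..b}\<close>
      by (simp add: has_real_derivative_iff_has_vector_derivative)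
  qed (use that in auto)
  have "((\<lambda>x. integral {a..x} g + u a) has_real_derivative g c + 0) (at c within {a..b})"
    using assms(1,2) by (intro DERIV_add integral_has_real_derivative[OF g] DERIV_const) auto
  then have "((\<lambda>x. integral {a..x} g + u a) has_real_derivative g c) (at c within {a..b})"
    by simp
  then have "(u has_real_derivative g c) (at c within {a..b})"
    by (rule has_field_derivative_transform_within[where d = 1]) (use assms(1,2) int in auto)
  then show ?thesis
    using assms(1,2) at_within_Icc_at[of a c b] by simp
qed

section \<open>The time map and the existence of a positive profile\<close>

definition time_map :: "real \<Rightarrow> (real \<Rightarrow> real) \<Rightarrow> bool" where
  "time_map p F \<longleftrightarrow> F 0 = 0 \<and> continuous_on {0..1} F \<and>
     (\<forall>s\<in>{0<..<1}. (F has_real_derivative 1 / sqrt (1 - s powr (p + 1))) (at s))"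

lemma time_mapD:
  assumes "time_map p F"
  shows "F 0 = 0" "continuous_on {0..1} F"
    "s \<in> {0<..<1} \<Longrightarrow> (F has_real_derivative 1 / sqrt (1 - s powr (p + 1))) (at s)"
  using assms by (auto simp: time_map_def)

text \<open>The integral of \<open>f\<close> over [0,s] works: on [0,1] the bound t^(p+1) <= t gives
  f(t) <= (1-t)^(-1/2), and the latter has the antiderivative -2 (1-t)^(1/2), continuous up to 1.
  The slope of F blows up at 1, which is why \<open>time_map\<close> asks only for continuity
  there.\<close>

lemma time_map_exists:
  fixes p :: real
  assumes "p > 0"
  shows "\<exists>F. time_map p F"
proof -
  define f where "f t = 1 / sqrt (1 - t powr (p + 1))" for t :: real
  have "((\<lambda>t. 1 / sqrt (1 - t)) has_integral (- 2 * sqrt (1 - 1)) - (- 2 * sqrt (1 - 0))) {0..1::real}"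
  proof (rule fundamental_theorem_of_calculus_interior)
    show "continuous_on {0..1} (\<lambda>t::real. - 2 * sqrt (1 - t))"
      by (intro continuous_intros)
    show "((\<lambda>t. - 2 * sqrt (1 - t)) has_vector_derivative 1 / sqrt (1 - x)) (at x)"
      if "x \<in> {0<..<1}" for x :: real
      using that unfolding has_real_derivative_iff_has_vector_derivative[symmetric]
      by (auto intro!: derivative_eq_intros simp: divide_simps)
  qed auto
  then have dom: "(\<lambda>t. 1 / sqrt (1 - t)) integrable_on {0..1::real}"
    by blast
  have bound: "norm (f t) \<le> 1 / sqrt (1 - t)" if "t \<in> {0..1}" for t
  \<comment> \<open>At \<open>t = 1\<close> both sides are \<open>1 / 0 = 0\<close>.\<close>
  proof (cases "t = 1")
    case False
    have "t powr (p + 1) \<le> t"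
      using powr_mono'[of 1 "p + 1" t] that assms by (cases "t = 0") auto
    then show ?thesis
      using that False unfolding f_def by (auto intro!: divide_left_mono mult_pos_pos)
  qed (simp add: f_def)
  have "f \<in> borel_measurable borel"
    unfolding f_def by measurable
  then have "f \<in> borel_measurable (lebesgue_on {0..1})"
    using borel_measurable_if_D borel_measurable_subalgebra
    by (simp add: measurable_completion measurable_restrict_space1)
  then have fint: "f integrable_on {0..1}"
    by (rule measurable_bounded_by_integrable_imp_integrable[OF _ dom bound]) auto
  have "time_map p (\<lambda>s. integral {0..s} f)"
    unfolding time_map_def
  proof (intro conjI ballI)
    show "integral {0..0} f = 0" by simp
    show "continuous_on {0..1} (\<lambda>s. integral {0..s} f)"
      by (rule indefinite_integral_continuous_1[OF fint])
    show "((\<lambda>s. integral {0..s} f) has_real_derivative 1 / sqrt (1 - s powr (p + 1))) (at s)"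
      if s: "s \<in> {0<..<1}" for s
    proof -
      \<comment> \<open>Stopping strictly between \<open>s\<close> and 1 leaves a compact interval
        on which the integrand is continuous.\<close>
      define c where "c = (1 + s) / 2"
      have c: "s < c" "c < 1" using s by (auto simp: c_def)
      have "t powr (p + 1) < 1" if "t \<in> {0..c}" for t
        using powr_less_mono2[of "p + 1" t 1] that c assms by auto
      then have "continuous_on {0..c} f"
        unfolding f_def using assms
        by (intro continuous_on_powr' continuous_intros) force+
      then have "((\<lambda>s. integral {0..s} f) has_real_derivative f s) (at s within {0..c})"
        using s c by (intro integral_has_real_derivative) auto
      then show ?thesis
        using at_within_Icc_at[of 0 s c] s c by (simp add: f_def)
    qed
  qed
  then show ?thesis by blast
qed

text \<open>The derivative is carried as an explicit companion \<open>d\<close>, and values outside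
  [0,1] are left free, so that reflecting or rescaling a profile needs no care with
  \<open>deriv\<close> or extensionality.\<close>

definition profile :: "real \<Rightarrow> (real \<Rightarrow> real) \<Rightarrow> (real \<Rightarrow> real) \<Rightarrow> bool" where
  "profile p u d \<longleftrightarrow> continuous_on {0..1} u \<and> u 0 = 0 \<and> u 1 = 0 \<and>
     (\<forall>x\<in>{0<..<1}. u x > 0 \<and> (u has_real_derivative d x) (at x) \<and>
        (d has_real_derivative - (u x powr p)) (at x))"

lemma time_map_strict_mono:
  assumes "p > 0" and F: "time_map p F"
  shows "strict_mono_on {0..1} F"
proof (rule strict_mono_onI)
  fix x y :: real assume xy: "x \<in> {0..1}" "y \<in> {0..1}" "x < y"
  show "F x < F y"
  proof (rule DERIV_pos_imp_increasing_open[OF \<open>x < y\<close>])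
    fix z assume z: "x < z" "z < y"
    then have "z powr (p + 1) < 1"
      using powr_less_mono2[of "p + 1" z 1] xy assms by auto
    then show "\<exists>y. (F has_real_derivative y) (at z) \<and> 0 < y"
      using time_mapD(3)[OF F, of z] z xy by auto
    next show "continuous_on {x..y} F"
      using time_mapD(2)[OF F] xy by (auto intro: continuous_on_subset)
  qed
qed

text \<open>Inverting the time map gives \<open>S\<close> with F(S x) = 2 T x, which rises from 0 to
  1 on [0,1/2] and has slope 2 T (1 - S^(p+1))^(1/2). A suitable multiple of \<open>S\<close> solves
  the equation there, and reflection in 1/2 supplies the other half.\<close>

lemma profile_exists:
  fixes p :: real
  assumes "p > 1"
  shows "\<exists>u d. profile p u d"
proof -
  obtain F where F0: "time_map p F"
    using time_map_exists[of p] assms by auto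
  note F = time_mapD[OF F0]
  have mono: "strict_mono_on {0..1} F"
    using time_map_strict_mono[OF _ F0] assms by simp
  define T where "T = F 1"
  have T: "T > 0"
    using strict_mono_onD[OF mono, of 0 1] F(1) by (simp add: T_def)
  have inj: "inj_on F {0..1}"
    using mono by (rule strict_mono_on_imp_inj_on)
  have img: "F ` {0..1} = {0..T}"
  proof
    have "mono_on {0..1} F" using mono by (rule strict_mono_on_imp_mono_on)
    then show "F ` {0..1} \<subseteq> {0..T}"
      using F(1) mono_onD[of "{0..1}" F 0] mono_onD[of "{0..1}" F _ 1] by (auto simp: T_def)
    show "{0..T} \<subseteq> F ` {0..1}"
      using IVT'[of F 0 _ 1] F(1,2) by (force simp: T_def)
  qed
  define S where "S x = the_inv_into {0..1} F (2 * T * x)" for x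
  have FS: "F (S x) = 2 * T * x" and Srange: "S x \<in> {0..1}" if "x \<in> {0..1/2}" for x
  proof -
    have "2 * T * x \<in> F ` {0..1}"
      unfolding img using that T by (auto simp: mult_le_cancel_left1 field_simps)
    then show "F (S x) = 2 * T * x" "S x \<in> {0..1}"
      unfolding S_def using inj
      by (blast intro: f_the_inv_into_f the_inv_into_into[THEN subsetD[rotated]] the_inv_into_into)+
  qed
  have S0: "S 0 = 0" and Shalf: "S (1/2) = 1"
    using the_inv_into_f_f[OF inj, of 0] the_inv_into_f_f[OF inj, of 1] F(1)
    by (auto simp: S_def T_def)
  have "continuous_on (F ` {0..1}) (the_inv_into {0..1} F)"
    by (rule continuous_on_inv) (use F(2) inj in \<open>auto simp: the_inv_into_f_f\<close>)
  then have Scont: "continuous_on {0..1/2} S"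
    unfolding S_def img
    by (rule continuous_on_compose2) (use T in \<open>auto intro!: continuous_intros simp: field_simps\<close>)
  have Sopen: "0 < S x" "S x < 1" if "x \<in> {0<..<1/2}" for x
  proof -
    have "S x \<noteq> 0" "S x \<noteq> 1"
      using FS[of x] that F(1) T by (auto simp: T_def)
    then show "0 < S x" "S x < 1" using Srange[of x] that by auto
  qed
  have S1: "S x powr (p + 1) < 1" if "x \<in> {0<..<1/2}" for x
    using powr_less_mono2[of "p + 1" "S x" 1] Sopen[OF that] assms by auto
  have S': "(S has_real_derivative 2 * T * sqrt (1 - S x powr (p + 1))) (at x)"
    if x: "x \<in> {0<..<1/2}" for x
  proof -
    have "((\<lambda>s. F s / (2 * T)) has_real_derivative 1 / sqrt (1 - S x powr (p + 1)) / (2 * T)) (at (S x))"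
      by (intro DERIV_cdivide F(3)) (use Sopen[OF x] in auto)
    moreover have "isCont S x"
      using continuous_on_interior[OF Scont, of x] x by simp
    ultimately have "(S has_real_derivative inverse (1 / sqrt (1 - S x powr (p + 1)) / (2 * T))) (at x)"
      using x FS T S1[OF x]
      by (intro DERIV_inverse_function[where a = 0 and b = "1/2" and f = "\<lambda>s. F s / (2 * T)"]) auto
    then show ?thesis by (simp add: field_simps)
  qed
  \<comment> \<open>Differentiating the slope of \<open>S\<close> once more gives second derivative
    -2 T^2 (p+1) S^p. So \<open>M * S\<close> solves the equation when M^(p-1) = 2 T^2
    (p+1).\<close>
  define M where "M = (2 * T^2 * (p + 1)) powr (1 / (p - 1))"
  have M: "M > 0" using T assms by (auto simp: M_def)
  have Mp: "M powr p = 2 * T^2 * (p + 1) * M"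
  proof -
    have "M powr (p - 1) = 2 * T^2 * (p + 1)"
      unfolding M_def powr_powr using assms T by simp
    then show ?thesis
      using M powr_add[of M "p - 1" 1] by simp
  qed
  define D where "D x = 2 * T * M * sqrt (1 - S x powr (p + 1))" for x
  define u where "u x = M * (if x \<le> 1/2 then S x else S (1 - x))" for x
  \<comment> \<open>The reflection is even for \<open>u\<close> and odd for \<open>d\<close>; the
    two halves of \<open>d\<close> fit together because \<open>D (1/2) = 0\<close>, as
    \<open>S (1/2) = 1\<close>.\<close>
  define d where "d x = (if x \<le> 1/2 then D x else - D (1 - x))" for x
  have Dcont: "continuous_on {0..1/2} D"
    unfolding D_def using Scont assms Srange
    by (intro continuous_on_powr' continuous_intros) auto
  have Sc': "continuous_on {1/2..1} (\<lambda>x. S (1 - x))" and Dc': "continuous_on {1/2..1} (\<lambda>x. D (1 - x))"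
    by (rule continuous_on_compose2[OF Scont] continuous_on_compose2[OF Dcont];
        auto intro!: continuous_intros)+
  have un: "{0..1} = {0..1/2} \<union> {1/2..1::real}" by auto
  have half_eq: "x = 1/2" if "x * 2 = 1" for x :: real
    using that by simp
  have half: "1 - x = x" if "x * 2 = 1" for x :: real
    using that by simp
  have ucont: "continuous_on {0..1} u"
    unfolding un u_def
    by (intro continuous_on_mult continuous_on_const continuous_on_cases Scont Sc')
       (auto simp: half)
  have dcont: "continuous_on {0..1} d"
    unfolding un d_def
    by (intro continuous_on_cases continuous_on_minus Dcont Dc') (auto simp: D_def half Shalf dest!: half_eq)
  have MS': "((\<lambda>x. M * S x) has_real_derivative D x) (at x)" if "x \<in> {0<..<1/2}" for x
    using DERIV_cmult[OF S'[OF that], of M] by (simp add: D_def mult_ac)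
  have D': "(D has_real_derivative - ((M * S x) powr p)) (at x)" if x: "x \<in> {0<..<1/2}" for x
  proof -
    have r: "sqrt (1 - S x powr (p + 1)) \<noteq> 0"
      using S1[OF x] by simp
    have "(D has_real_derivative 2 * T * M * (inverse (sqrt (1 - S x powr (p + 1))) / 2
        * (0 - (p + 1) * S x powr p * (2 * T * sqrt (1 - S x powr (p + 1)))))) (at x)"
      unfolding D_def using S'[OF x] S1[OF x] Sopen[OF x]
      by (auto intro!: derivative_eq_intros)
    also have "2 * T * M * (inverse (sqrt (1 - S x powr (p + 1))) / 2
        * (0 - (p + 1) * S x powr p * (2 * T * sqrt (1 - S x powr (p + 1)))))
      = - ((M * S x) powr p)"
      using r Sopen[OF x] M by (simp add: powr_mult Mp power2_eq_square)
    finally show ?thesis .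
  qed
  have u': "(u has_real_derivative d x) (at x)" if x: "x \<in> {0<..<1} - {1/2}" for x
  proof (cases "x < 1/2")
    case True
    then have "((\<lambda>x. M * S x) has_real_derivative d x) (at x)"
      using MS'[of x] x by (simp add: d_def)
    then show ?thesis
      by (rule has_field_derivative_transform_within_open[where S = "{..<1/2}"])
         (use True in \<open>auto simp: u_def\<close>)
  next
    case False
    then have "((\<lambda>x. M * S (1 - x)) has_real_derivative D (1 - x) * (-1)) (at x)"
      using x by (intro DERIV_chain2[OF MS'] derivative_eq_intros) auto
    then have "((\<lambda>x. M * S (1 - x)) has_real_derivative d x) (at x)"
      using x False by (simp add: d_def)
    then show ?thesis
      by (rule has_field_derivative_transform_within_open[where S = "{1/2<..}"])
         (use x False in \<open>auto simp: u_def\<close>)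
  qed
  have d': "(d has_real_derivative - (u x powr p)) (at x)" if x: "x \<in> {0<..<1} - {1/2}" for x
  proof (cases "x < 1/2")
    case True
    then have "(D has_real_derivative - (u x powr p)) (at x)"
      using D'[of x] x by (simp add: u_def)
    then show ?thesis
      by (rule has_field_derivative_transform_within_open[where S = "{..<1/2}"])
         (use True in \<open>auto simp: d_def\<close>)
  next
    case False
    then have "((\<lambda>x. - D (1 - x)) has_real_derivative - (- ((M * S (1 - x)) powr p) * (-1))) (at x)"
      using x by (intro DERIV_minus DERIV_chain2[OF D'] derivative_eq_intros) auto
    then have "((\<lambda>x. - D (1 - x)) has_real_derivative - (u x powr p)) (at x)"
      using x False by (simp add: u_def)
    then show ?thesis
      by (rule has_field_derivative_transform_within_open[where S = "{1/2<..}"])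
         (use x False in \<open>auto simp: d_def\<close>)
  qed
  have pcont: "continuous_on {0..1} (\<lambda>x. - (u x powr p))"
    using ucont assms Srange M
    by (intro continuous_on_powr' continuous_intros) (auto simp: u_def)
  \<comment> \<open>At the midpoint \<open>S\<close> is not known to be differentiable; there both
    derivatives come from the continuity of \<open>d\<close> and of u^p.\<close>
  have "(u has_real_derivative d (1/2)) (at (1/2))"
    by (rule has_real_derivative_exceptional_point[OF _ _ ucont dcont u']) auto
  with u' have "(u has_real_derivative d x) (at x)" if "x \<in> {0<..<1}" for x
    using that by (cases "x = 1/2") (auto dest!: half_eq)
  moreover have "(d has_real_derivative - (u (1/2) powr p)) (at (1/2))"
    by (rule has_real_derivative_exceptional_point[OF _ _ dcont pcont d']) auto
  with d' have "(d has_real_derivative - (u x powr p)) (at x)" if "x \<in> {0<..<1}" for x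
    using that by (cases "x = 1/2") (auto dest!: half_eq)
  moreover have "u x > 0" if "x \<in> {0<..<1}" for x
    using that M Sopen[of x] Sopen[of "1 - x"] Shalf
    by (cases x "1/2 :: real" rule: linorder_cases) (auto simp: u_def dest!: half_eq)
  ultimately have "profile p u d"
    unfolding profile_def using ucont S0 by (auto simp: u_def[of 0] u_def[of 1])
  then show ?thesis by blast
qed

section \<open>Uniqueness of the positive profile\<close>

lemma profile_reflect:
  assumes "profile p u d"
  shows "profile p (\<lambda>x. u (1 - x)) (\<lambda>x. - d (1 - x))"
proof -
  have "continuous_on {0..1} (\<lambda>x. u (1 - x))"
    by (rule continuous_on_compose2[of "{0..1}" u])
       (use assms in \<open>auto simp: profile_def intro!: continuous_intros\<close>)
  moreover have "((\<lambda>x. u (1 - x)) has_real_derivative - d (1 - x)) (at x)"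
    and "((\<lambda>x. - d (1 - x)) has_real_derivative - (u (1 - x) powr p)) (at x)"
    if x: "x \<in> {0<..<1}" for x
  proof -
    have *: "(u has_real_derivative d (1 - x)) (at (1 - x))"
      "(d has_real_derivative - (u (1 - x) powr p)) (at (1 - x))"
      using assms x by (auto simp: profile_def)
    have r: "((\<lambda>x. 1 - x) has_real_derivative -1) (at x)"
      by (auto intro!: derivative_eq_intros)
    show "((\<lambda>x. u (1 - x)) has_real_derivative - d (1 - x)) (at x)"
      and "((\<lambda>x. - d (1 - x)) has_real_derivative - (u (1 - x) powr p)) (at x)"
      using DERIV_chain2[OF *(1) r] DERIV_minus[OF DERIV_chain2[OF *(2) r]] by auto
  qed
  ultimately show ?thesis
    using assms by (auto simp: profile_def)
qed

text \<open>The boundary values 0 lie below \<open>u (1/2)\<close>, so the maximum is attained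
  inside and the derivative vanishes there.\<close>

lemma profile_max:
  assumes "profile p u d"
  obtains c where "c \<in> {0<..<1}" "\<forall>x\<in>{0..1}. u x \<le> u c" "d c = 0"
proof -
  have "\<exists>c\<in>{0..1}. \<forall>x\<in>{0..1}. u x \<le> u c"
    by (rule continuous_attains_sup) (use assms in \<open>auto simp: profile_def\<close>)
  then obtain c where c: "c \<in> {0..1}" "\<forall>x\<in>{0..1}. u x \<le> u c" by blast
  have "u (1/2) > 0" using assms by (auto simp: profile_def)
  with c(2)[rule_format, of "1/2"] have "u c > 0" by auto
  then have c1: "c \<in> {0<..<1}"
    using assms c(1) by (cases "c = 0"; cases "c = 1") (auto simp: profile_def)
  have "d c = 0"
  proof (rule DERIV_local_max)
    show "(u has_real_derivative d c) (at c)"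
      using assms c1 by (auto simp: profile_def)
    show "0 < min c (1 - c)" using c1 by auto
    show "\<forall>y. \<bar>c - y\<bar> < min c (1 - c) \<longrightarrow> u y \<le> u c"
      using c(2) by (auto simp: abs_if split: if_splits)
  qed
  with c1 c(2) show thesis by (rule that)
qed

text \<open>The energy d^2/2 + u^(p+1)/(p+1) is conserved, and its value is known at the maximum
  point \<open>c\<close>. Since d > 0 to the left of \<open>c\<close>, this determines d as a
  function of u, and separating variables shows that F(u/M) grows at the constant rate
  \<open>k\<close>.\<close>

lemma profile_time:
  fixes p :: real
  assumes p: "p > 1" and prof: "profile p u d"
    and c: "c \<in> {0<..<1}" "\<forall>x\<in>{0..1}. u x \<le> u c" "d c = 0"
    and F: "time_map p F"
    and x: "x \<in> {0..c}"
  shows "F (u x / u c) = sqrt (2 / (p + 1)) * u c powr ((p - 1) / 2) * x"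
proof -
  define M where "M = u c"
  define k where "k = sqrt (2 / (p + 1)) * M powr ((p - 1) / 2)"
  have u: "continuous_on {0..1} u" "u 0 = 0"
    "\<And>x. x \<in> {0<..<1} \<Longrightarrow> u x > 0"
    "\<And>x. x \<in> {0<..<1} \<Longrightarrow> (u has_real_derivative d x) (at x)"
    "\<And>x. x \<in> {0<..<1} \<Longrightarrow> (d has_real_derivative - (u x powr p)) (at x)"
    using prof by (auto simp: profile_def)
  have M: "M > 0" using u(3) c(1) by (simp add: M_def)
  \<comment> \<open>A positive solution is strictly concave, so \<open>d\<close> decreases strictly
    to its zero at \<open>c\<close>.\<close>
  have dpos: "d y > 0" if "y \<in> {0<..<c}" for y
  proof -
    have "d c < d y"
    proof (rule DERIV_neg_imp_decreasing[where f = d and a = y and b = c])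
      fix z assume z: "y \<le> z" "z \<le> c"
      then have "z \<in> {0<..<1}" using that c(1) by auto
      then show "\<exists>e. (d has_real_derivative e) (at z) \<and> e < 0"
        using u(3)[of z] u(5)[of z] by (auto intro!: exI[of _ "- (u z powr p)"])
    qed (use that in simp)
    then show ?thesis using c(3) by simp
  qed
  have less: "u y < M" if "y \<in> {0<..<c}" for y
    unfolding M_def
  proof (rule DERIV_pos_imp_increasing_open[where f = u and a = y and b = c])
    show "y < c" using that by simp
    show "\<exists>e. (u has_real_derivative e) (at z) \<and> 0 < e" if "y < z" "z < c" for z
      using dpos[of z] u(4)[of z] that \<open>y \<in> {0<..<c}\<close> c(1) by auto
    show "continuous_on {y..c} u"
      using u(1) that c(1) by (auto intro: continuous_on_subset)
  qed
  have d2: "(d y)^2 = 2 / (p + 1) * (M powr (p + 1) - u y powr (p + 1))" if y: "y \<in> {0<..<1}" for y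
  proof -
    define E where "E z = (d z)^2 / 2 + u z powr (p + 1) / (p + 1)" for z
    have "(E has_real_derivative 0) (at z)" if z: "z \<in> {0<..<1}" for z
    proof -
      have "(E has_real_derivative (2 * (d z * - (u z powr p))) / 2
          + ((p + 1) * u z powr p * d z) / (p + 1)) (at z)"
        unfolding E_def using u(3,4,5)[OF z] p
        by (auto intro!: derivative_eq_intros)
      then show ?thesis using p by simp
    qed
    then have "E y = E c"
      using DERIV_isconst3[of 0 1 y c E] y c(1) by simp
    then have "(d y)^2 = 2 * (M powr (p + 1) / (p + 1) - u y powr (p + 1) / (p + 1))"
      using c(3) by (simp add: E_def M_def)
    then show ?thesis
      using c(3) by (simp add: E_def M_def right_diff_distrib diff_divide_distrib)
  qed
  define G where "G y = F (u y / M) - k * y" for y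
  \<comment> \<open>The argument u/M reaches 1 at \<open>c\<close>, where F need not be
    differentiable; a zero derivative inside and continuity up to \<open>c\<close> suffice.\<close>
  have "G x = G 0"
  proof (rule DERIV_isconst2[where f = G and a = 0 and b = c and x = x])
    show "0 < c" "0 \<le> x" "x \<le> c" using c(1) x by auto
    have uy: "u y / M \<in> {0..1}" if "y \<in> {0..c}" for y
      using that c(1) c(2)[rule_format, of y] u(2) u(3)[of y] M by (cases "y = 0") (auto simp: M_def)
    show "continuous_on {0..c} G"
      unfolding G_def
      by (intro continuous_on_diff continuous_on_compose2[OF time_mapD(2)[OF F]] continuous_intros
            continuous_on_subset[OF u(1)]) (use c(1) M uy in auto)
    show "(G has_real_derivative 0) (at y)" if "0 < y" "y < c" for y
    proof -
      have y: "y \<in> {0<..<1}" and s: "u y / M \<in> {0<..<1}"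
        using that c(1) u(3)[of y] less[of y] M by auto
      define r where "r = sqrt (1 - (u y / M) powr (p + 1))"
      have "(u y / M) powr (p + 1) < 1"
        using powr_less_mono2[of "p + 1" "u y / M" 1] s p by auto
      then have r: "r > 0" by (simp add: r_def)
      have "(d y)^2 = 2 / (p + 1) * (M powr (p + 1) * (1 - (u y / M) powr (p + 1)))"
        using d2[OF y] u(3)[OF y] M by (simp add: powr_divide algebra_simps)
      then have "d y = sqrt (2 / (p + 1) * (M powr (p + 1) * (1 - (u y / M) powr (p + 1))))"
        using dpos[of y] that by (intro real_sqrt_unique[symmetric]) auto
      also have "\<dots> = sqrt (2 / (p + 1)) * (sqrt (M powr (p + 1)) * r)"
        unfolding real_sqrt_mult r_def ..
      also have "sqrt (M powr (p + 1)) = M powr ((p - 1) / 2) * M"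
        using M powr_add[of M "(p - 1) / 2" 1]
        by (simp add: powr_half_sqrt[symmetric] powr_powr field_simps)
      finally have dy: "d y / M = k * r"
        using M by (simp add: k_def)
      have "((\<lambda>y. F (u y / M)) has_real_derivative 1 / r * (d y / M)) (at y)"
        unfolding r_def
        by (rule DERIV_chain2[where f = F]; intro time_mapD(3)[OF F s] DERIV_cdivide u(4) y)
      then have "(G has_real_derivative 1 / r * (d y / M) - k * 1) (at y)"
        unfolding G_def by (intro derivative_intros) auto
      then show ?thesis using r by (simp add: dy)
    qed
  qed
  then show ?thesis
    using time_mapD(1)[OF F] u(2) by (simp add: G_def k_def M_def)
qed

text \<open>The profile and its reflection have the same maximum value, hence the same rate k.
  Evaluating \<open>profile_time\<close> at the maximum points gives F(1) = k c and F(1) = k (1 -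
  c), so c = 1/2 and k = 2 F(1).\<close>

lemma profile_half:
  fixes p :: real
  assumes p: "p > 1" and prof: "profile p u d"
    and F: "time_map p F"
  shows "sqrt (2 / (p + 1)) * u (1/2) powr ((p - 1) / 2) = 2 * F 1"
    and "x \<in> {0..1} \<Longrightarrow> u x \<le> u (1/2)"
    and "x \<in> {0..1/2} \<Longrightarrow> F (u x / u (1/2)) = 2 * F 1 * x"
proof -
  obtain c where c: "c \<in> {0<..<1}" "\<forall>x\<in>{0..1}. u x \<le> u c" "d c = 0"
    using profile_max[OF prof] by metis
  have pos: "u c > 0" using prof c(1) by (auto simp: profile_def)
  note time = profile_time[OF p prof c F]
  have "F 1 = sqrt (2 / (p + 1)) * u c powr ((p - 1) / 2) * c"
    using time[of c] c(1) pos by simp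
  moreover have "F 1 = sqrt (2 / (p + 1)) * u c powr ((p - 1) / 2) * (1 - c)"
    using profile_time[OF p profile_reflect[OF prof] _ _ _ F, of "1 - c" "1 - c"] c pos by simp
  moreover have "sqrt (2 / (p + 1)) * u c powr ((p - 1) / 2) > 0"
    using p pos by simp
  ultimately have ch: "c = 1 / 2" and "sqrt (2 / (p + 1)) * u c powr ((p - 1) / 2) = 2 * F 1"
    by auto
  then have k: "sqrt (2 / (p + 1)) * u (1/2) powr ((p - 1) / 2) = 2 * F 1" by (simp only:)
  then show "sqrt (2 / (p + 1)) * u (1/2) powr ((p - 1) / 2) = 2 * F 1" .
  from k show "F (u x / u (1/2)) = 2 * F 1 * x" if "x \<in> {0..1/2}"
    using time[of x] that by (simp add: ch)
  show "u x \<le> u (1/2)" if "x \<in> {0..1}"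
    using c(2) that by (simp add: ch)
qed

text \<open>By \<open>profile_half\<close> the height is fixed by F(1), because a positive power is
  injective on positive numbers. Then injectivity of F fixes the left half, and the reflected
  profiles give the right half.\<close>

lemma profile_unique:
  fixes p :: real
  assumes p: "p > 1" and u: "profile p u d" and v: "profile p v e" and x: "x \<in> {0..1}"
  shows "u x = v x"
proof -
  obtain F where F: "time_map p F"
    using time_map_exists[of p] p by auto
  have inj: "inj_on F {0..1}"
    using time_map_strict_mono[OF _ F] p by (intro strict_mono_on_imp_inj_on) simp
  have eq: "u x = v x" if "profile p u d" "profile p v e" and x: "x \<in> {0..1/2}" for u v d e x
  proof -
    note U = profile_half[OF p that(1) F] and V = profile_half[OF p that(2) F]
    have pos: "u (1/2) > 0" "v (1/2) > 0"
      using that(1,2) by (auto simp: profile_def)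
    have nn: "u x \<ge> 0" "v x \<ge> 0"
      using that by (cases "x = 0"; force simp: profile_def less_imp_le)+
    have "u (1/2) powr ((p - 1) / 2) = v (1/2) powr ((p - 1) / 2)"
      using trans[OF U(1) V(1)[symmetric]] p by simp
    then have M: "u (1/2) = v (1/2)"
      using pos p powr_less_mono2[of "(p - 1) / 2" "u (1/2)" "v (1/2)"]
        powr_less_mono2[of "(p - 1) / 2" "v (1/2)" "u (1/2)"]
      by (cases "u (1/2)" "v (1/2)" rule: linorder_cases) auto
    have "u x / u (1/2) = v x / u (1/2)"
    proof (rule inj_onD[OF inj])
      show "F (u x / u (1/2)) = F (v x / u (1/2))"
        using U(3)[OF x] V(3)[OF x] by (simp add: M)
      show "u x / u (1/2) \<in> {0..1}" "v x / u (1/2) \<in> {0..1}"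
        using pos nn U(2)[of x] V(2)[of x] x by (auto simp: M)
    qed
    then show ?thesis using pos by simp
  qed
  show ?thesis
  proof (cases "x \<le> 1/2")
    case False
    then show ?thesis
      using eq[OF profile_reflect[OF u] profile_reflect[OF v], of "1 - x"] x by simp
  qed (use eq[OF u v] x in simp)
qed

section \<open>From profiles to classical solutions and multiples of W\<close>

lemma C2_onD:
  assumes "C2_on S u" "open S" "x \<in> S"
  shows "(u has_real_derivative deriv u x) (at x)"
    and "(deriv u has_real_derivative deriv (deriv u) x) (at x)"
  using assms
  by (auto simp: C2_on_def differentiable_on_eq_differentiable_at DERIV_deriv_iff_real_differentiable)

text \<open>\<open>deriv u\<close> is known to agree with \<open>d\<close> only on \<open>S\<close>;
  as \<open>S\<close> is open, this suffices for the derivatives to agree.\<close>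

lemma C2_onI:
  fixes u d f :: "real \<Rightarrow> real"
  assumes S: "open S"
    and u: "\<And>x. x \<in> S \<Longrightarrow> (u has_real_derivative d x) (at x)"
    and d: "\<And>x. x \<in> S \<Longrightarrow> (d has_real_derivative f x) (at x)"
    and f: "continuous_on S f"
  shows "C2_on S u" and "x \<in> S \<Longrightarrow> deriv (deriv u) x = f x"
proof -
  have du: "(deriv u has_real_derivative f x) (at x)" if "x \<in> S" for x
    by (rule has_field_derivative_transform_within_open[OF d S])
       (use that u in \<open>auto intro: DERIV_imp_deriv[symmetric]\<close>)
  then have eq: "deriv (deriv u) x = f x" if "x \<in> S" for x
    using that by (auto intro: DERIV_imp_deriv)
  then show "x \<in> S \<Longrightarrow> deriv (deriv u) x = f x" .
  have "u differentiable_on S" "deriv u differentiable_on S"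
    unfolding differentiable_on_eq_differentiable_at[OF S]
    using u du by (blast intro: real_differentiable_def[THEN iffD2])+
  moreover have "continuous_on S (deriv (deriv u))"
    using f eq by (simp cong: continuous_on_cong)
  ultimately show "C2_on S u"
    by (simp add: C2_on_def)
qed

lemma profile_continuous_powr:
  assumes "profile p u d" "p > 0"
  shows "continuous_on {0..1} (\<lambda>x. u x powr p)" and "x \<in> {0..1} \<Longrightarrow> u x \<ge> 0"
proof -
  have nn: "u x \<ge> 0" if "x \<in> {0..1}" for x
    using assms that by (cases "x = 0"; cases "x = 1") (auto simp: profile_def less_imp_le)
  then show "x \<in> {0..1} \<Longrightarrow> u x \<ge> 0" .
  show "continuous_on {0..1} (\<lambda>x. u x powr p)"
    using assms nn by (intro continuous_on_powr' continuous_intros) (auto simp: profile_def)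
qed

text \<open>The second derivative scales like c and the p-th power like c^p, so multiples of a
  single profile cover every constant in front of the second derivative. Restriction to [0,1]
  supplies the extensionality required by \<open>classical\<close> and leaves interior derivatives
  unchanged.\<close>

lemma scaled_profile:
  fixes c :: real
  assumes u: "profile p u d" and p: "p > 1" and c: "c > 0"
    and v: "v = restrict (\<lambda>x. c * u x) {0..1}"
  shows "classical v" "v 0 = 0" "v 1 = 0"
    and "x \<in> {0<..<1} \<Longrightarrow> v x > 0"
    and "x \<in> {0<..<1} \<Longrightarrow> deriv (deriv v) x = - (c * u x powr p)"
    and "integral {0..1} (\<lambda>x. \<bar>v x\<bar> powr p) = c powr p * integral {0..1} (\<lambda>x. \<bar>u x\<bar> powr p)"
proof -
  have v': "(v has_real_derivative c * d x) (at x)" if x: "x \<in> {0<..<1}" for x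
    by (rule has_field_derivative_transform_within_open[where S = "{0<..<1}" and f = "\<lambda>x. c * u x"])
       (use u x in \<open>auto simp: profile_def v intro!: DERIV_cmult\<close>)
  have d': "((\<lambda>x. c * d x) has_real_derivative - (c * u x powr p)) (at x)" if x: "x \<in> {0<..<1}" for x
    using DERIV_cmult[of d "- (u x powr p)" x UNIV c] u x by (auto simp: profile_def)
  have "continuous_on {0<..<1} (\<lambda>x. u x powr p)"
    using profile_continuous_powr(1)[OF u] p by (auto intro: continuous_on_subset)
  then have c: "continuous_on {0<..<1} (\<lambda>x. - (c * u x powr p))"
    by (intro continuous_on_minus continuous_on_mult continuous_on_const)
  have "continuous_on {0..1} v"
    by (rule continuous_on_eq[of _ "\<lambda>x. c * u x"])
       (use u in \<open>auto simp: profile_def v intro!: continuous_intros\<close>)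
  then show "classical v"
    using C2_onI(1)[OF _ v' d' c] by (simp add: classical_def v)
  show "x \<in> {0<..<1} \<Longrightarrow> deriv (deriv v) x = - (c * u x powr p)"
    using C2_onI(2)[OF _ v' d' c, of x] by simp
  show "v 0 = 0" "v 1 = 0" "x \<in> {0<..<1} \<Longrightarrow> v x > 0"
    using u \<open>c > 0\<close> by (auto simp: profile_def v)
  have "integral {0..1} (\<lambda>x. \<bar>v x\<bar> powr p) = integral {0..1} (\<lambda>x. c powr p * \<bar>u x\<bar> powr p)"
    by (rule integral_cong) (use \<open>c > 0\<close> in \<open>auto simp: v abs_mult powr_mult\<close>)
  then show "integral {0..1} (\<lambda>x. \<bar>v x\<bar> powr p) = c powr p * integral {0..1} (\<lambda>x. \<bar>u x\<bar> powr p)"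
    by simp
qed

text \<open>Multiplying u by s removes the constant K exactly when s^(p-1) = 1/K, which is the
  chosen factor.\<close>

lemma classical_profile:
  fixes p K :: real
  assumes u: "classical u" "\<forall>x\<in>{0<..<1}. - (K * deriv (deriv u) x) = u x powr p"
      "\<forall>x\<in>{0<..<1}. u x > 0" "u 0 = 0" "u 1 = 0"
    and p: "p > 1" and K: "K > 0"
  shows "profile p (\<lambda>x. K powr (1 / (1 - p)) * u x) (\<lambda>x. K powr (1 / (1 - p)) * deriv u x)"
proof -
  define s where "s = K powr (1 / (1 - p))"
  have s: "s > 0" using K by (simp add: s_def)
  have "s powr p = s * s powr (p - 1)"
    using powr_add[of s 1 "p - 1"] s by simp
  also have "s powr (p - 1) = 1 / K"
  proof -
    have "1 / (1 - p) * (p - 1) = - 1" using p by (simp add: field_simps)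
    then show ?thesis using K by (simp add: s_def powr_powr powr_minus_divide)
  qed
  finally have sp: "s powr p = s / K" using s by simp
  have C2: "C2_on {0<..<1} u" using u(1) by (simp add: classical_def)
  have "(deriv u has_real_derivative - (u x powr p / K)) (at x)" if "x \<in> {0<..<1}" for x
  proof -
    have "deriv (deriv u) x = - (u x powr p / K)"
      using u(2)[rule_format, OF that] K by (simp add: field_simps)
    then show ?thesis using C2_onD(2)[OF C2 _ that] by simp
  qed
  then have "((\<lambda>x. s * deriv u x) has_real_derivative - ((s * u x) powr p)) (at x)"
    if "x \<in> {0<..<1}" for x
    using DERIV_cmult[of "deriv u" "- (u x powr p / K)" x UNIV s] that u(3) s
    by (simp add: powr_mult sp)
  moreover have "continuous_on {0..1} u" using u(1) by (simp add: classical_def)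
  ultimately have "profile p (\<lambda>x. s * u x) (\<lambda>x. s * deriv u x)"
    using u(3-5) s C2_onD(1)[OF C2] unfolding profile_def
    by (auto intro!: continuous_intros DERIV_cmult)
  then show ?thesis by (simp add: s_def)
qed

text \<open>Existence and uniqueness of profiles justify the definite description behind
  \<open>W\<close>; extensionality settles equality outside [0,1].\<close>

lemma W_profile:
  fixes p :: real
  assumes p: "p > 1"
  shows "\<exists>d. profile p (W p) d"
proof -
  let ?P = "\<lambda>w. classical w \<and> (\<forall>x\<in>{0<..<1}. - deriv (deriv w) x = w x powr p)
            \<and> (\<forall>x\<in>{0<..<1}. w x > 0) \<and> w 0 = 0 \<and> w 1 = 0"
  have prof: "profile p w (deriv w)" if "?P w" for w
    using classical_profile[of w 1 p] that p by simp
  obtain u d where u: "profile p u d"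
    using profile_exists[OF p] by blast
  \<comment> \<open>The factor 1 puts \<open>w\<close> in the form treated by
    \<open>scaled_profile\<close>.\<close>
  define w where "w = restrict (\<lambda>x. 1 * u x) {0..1}"
  have "?P w"
    using scaled_profile[OF u p zero_less_one w_def] by (auto simp: w_def)
  moreover have "v = w" if "?P v" for v
  proof
    fix x show "v x = w x"
      using profile_unique[OF p prof[OF that] prof[OF \<open>?P w\<close>], of x] that \<open>?P w\<close>
      by (cases "x \<in> {0..1}") (auto simp: classical_def extensional_def)
  qed
  ultimately have "?P (W p)"
    unfolding W_def by (rule theI)
  then show ?thesis
    using prof[of "W p"] by blast
qed

lemma Lp_norm_W:
  fixes p :: real
  assumes p: "p > 1"
  shows "Lp_norm p (W p) > 0"
    and "Lp_norm p (W p) powr p = integral {0..1} (\<lambda>x. \<bar>W p x\<bar> powr p)"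
proof -
  obtain d where d: "profile p (W p) d" using W_profile[OF p] by blast
  have cont: "continuous_on {0..1} (\<lambda>x. \<bar>W p x\<bar> powr p)"
    by (rule continuous_on_eq[OF profile_continuous_powr(1)[OF d]])
       (use profile_continuous_powr(2)[OF d] p in auto)
  have "integral {0..1} (\<lambda>x::real. 0::real) < integral {0..1} (\<lambda>x. \<bar>W p x\<bar> powr p)"
  proof (rule integral_less_real[OF continuous_on_const cont])
    show "0 < \<bar>W p x\<bar> powr p" if "x \<in> {0<..<1}" for x
      using d that by (force simp: profile_def)
  qed simp
  then have "integral {0..1} (\<lambda>x. \<bar>W p x\<bar> powr p) > 0" by simp
  then show "Lp_norm p (W p) > 0"
    and "Lp_norm p (W p) powr p = integral {0..1} (\<lambda>x. \<bar>W p x\<bar> powr p)"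
    using p by (auto simp: Lp_norm_def powr_powr)
qed

text \<open>For a fixed u the nonlocal factor is a positive constant, so rescaling u yields a
  profile, which must be \<open>W p\<close> on [0,1]. Inserting c W_p into (P) and cancelling c
  W_p^p leaves the scalar equation.\<close>

lemma solution_iff:
  fixes b p q lam :: real
  assumes b: "b > 0" and p: "p > 1" and lam: "lam > 0"
  shows "solution b p q lam u \<longleftrightarrow>
    (\<exists>c>0. (Lp_norm p (W p) powr p * c powr p + b) powr q = lam * c powr (p - 1)
       \<and> u = restrict (\<lambda>x. c * W p x) {0..1})"
proof -
  define A where "A = Lp_norm p (W p) powr p"
  have A: "A > 0"
    using Lp_norm_W(1)[OF p] by (simp add: A_def)
  note A_int = Lp_norm_W(2)[OF p, folded A_def]
  obtain d where d: "profile p (W p) d" using W_profile[OF p] by blast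
  have "solution b p q lam (restrict (\<lambda>x. c * W p x) {0..1}) \<longleftrightarrow>
      (A * c powr p + b) powr q = lam * c powr (p - 1)" if c: "c > 0" for c
  proof -
    define v where "v = restrict (\<lambda>x. c * W p x) {0..1}"
    note sc = scaled_profile[OF d p c v_def]
    have W: "W p x > 0" if "x \<in> {0<..<1}" for x
      using d that by (auto simp: profile_def)
    have cp: "c powr p = c * c powr (p - 1)"
      using powr_add[of c 1 "p - 1"] c by simp
    have "- ((integral {0..1} (\<lambda>y. \<bar>v y\<bar> powr p) + b) powr q) * deriv (deriv v) x = lam * v x powr p
        \<longleftrightarrow> (A * c powr p + b) powr q = lam * c powr (p - 1)" if x: "x \<in> {0<..<1}" for x
    proof -
      have "v x powr p = c powr p * W p x powr p"
        using x W[OF x] c by (simp add: v_def powr_mult)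
      then show ?thesis
        unfolding sc(5)[OF x] sc(6) A_int[symmetric] using W[OF x] c
        by (simp add: cp mult.commute)
    qed
    \<comment> \<open>The scalar condition does not involve x, so one interior point is enough to
      recover it from the differential equation.\<close>
    moreover have "(1/2 :: real) \<in> {0<..<1}" by simp
    ultimately show ?thesis
      unfolding solution_def v_def[symmetric] using sc(1-4) by blast
  qed
  moreover have "\<exists>c>0. u = restrict (\<lambda>x. c * W p x) {0..1}" if "solution b p q lam u"
  proof -
    define K where "K = (integral {0..1} (\<lambda>y. \<bar>u y\<bar> powr p) + b) powr q / lam"
    have "integral {0..1} (\<lambda>y. \<bar>u y\<bar> powr p) \<ge> 0"
      by (cases "(\<lambda>y. \<bar>u y\<bar> powr p) integrable_on {0..1}")
         (auto intro: integral_nonneg simp: not_integrable_integral)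
    then have K: "K > 0" using b lam by (simp add: K_def)
    define s where "s = K powr (1 / (1 - p))"
    have s: "s > 0" using K by (simp add: s_def)
    have "profile p (\<lambda>x. s * u x) (\<lambda>x. s * deriv u x)"
      unfolding s_def
      by (rule classical_profile) (use that lam p K in \<open>auto simp: solution_def K_def field_simps\<close>)
    then have "s * u x = W p x" if "x \<in> {0..1}" for x
      using profile_unique[OF p _ d] that by blast
    then have "u x = inverse s * W p x" if "x \<in> {0..1}" for x
      using that s by (metis less_irrefl mult.assoc left_inverse mult_1)
    moreover have "u \<in> extensional {0..1}"
      using that by (auto simp: solution_def classical_def)
    ultimately have "u = restrict (\<lambda>x. inverse s * W p x) {0..1}"
      by (intro extensionalityI[of _ "{0..1}"]) auto
    then show ?thesis using s positive_imp_inverse_positive by blast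
  qed
  ultimately show ?thesis
    unfolding A_def by metis
qed

section \<open>The scalar equation\<close>

text \<open>For t above the minimum \<open>G c0\<close>, the intermediate value theorem gives a root
  on each side of \<open>c0\<close>, and strict monotonicity makes it the only one there. Once t
  exceeds G at a given point, monotonicity pushes the roots beyond that point, towards 0 or
  infinity.\<close>

lemma two_branches:
  fixes G :: "real \<Rightarrow> real"
  assumes c0: "c0 > 0" and cont: "continuous_on {0<..} G"
    and dec: "\<And>x y. 0 < x \<Longrightarrow> x < y \<Longrightarrow> y \<le> c0 \<Longrightarrow> G y < G x"
    and inc: "\<And>x y. c0 \<le> x \<Longrightarrow> x < y \<Longrightarrow> G x < G y"
    and lim0: "filterlim G at_top (at_right 0)" and lim_top: "filterlim G at_top at_top"
  obtains c1 c2 where "(c1 \<longlongrightarrow> 0) at_top" "filterlim c2 at_top at_top"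
    "\<forall>\<^sub>F t in at_top. 0 < c1 t \<and> c1 t < c2 t \<and> (\<forall>c>0. G c = t \<longleftrightarrow> c = c1 t \<or> c = c2 t)"
proof -
  define P1 where "P1 t c \<longleftrightarrow> 0 < c \<and> c < c0 \<and> G c = t" for t c
  define P2 where "P2 t c \<longleftrightarrow> c0 < c \<and> G c = t" for t c
  have ex1: "\<exists>c. P1 t c" if t: "t > G c0" for t
  proof -
    have "\<forall>\<^sub>F a in at_right 0. G a \<ge> t \<and> a \<in> {0<..<c0}"
      using lim0 c0 by (intro eventually_conj eventually_at_right_real)
        (auto simp: filterlim_at_top)
    then obtain a where a: "G a \<ge> t" "0 < a" "a < c0"
      using eventually_happens'[OF trivial_limit_at_right_real] by force
    have "\<exists>x\<ge>a. x \<le> c0 \<and> G x = t"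
      by (rule IVT2') (use a t cont in \<open>auto intro: continuous_on_subset\<close>)
    then obtain x where x: "a \<le> x" "x \<le> c0" "G x = t" by blast
    with t have "x \<noteq> c0" by auto
    with x a show ?thesis by (intro exI[of _ x]) (auto simp: P1_def)
  qed
  have ex2: "\<exists>c. P2 t c" if t: "t > G c0" for t
  proof -
    have "\<forall>\<^sub>F a in at_top. G a \<ge> t \<and> a > c0"
      using lim_top by (intro eventually_conj eventually_gt_at_top) (auto simp: filterlim_at_top)
    then obtain a where a: "G a \<ge> t" "c0 < a"
      using eventually_happens'[OF trivial_limit_at_top_linorder] by force
    have "\<exists>x\<ge>c0. x \<le> a \<and> G x = t"
      by (rule IVT') (use a t c0 cont in \<open>auto intro: continuous_on_subset\<close>)
    then obtain x where x: "c0 \<le> x" "x \<le> a" "G x = t" by blast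
    with t have "x \<noteq> c0" by auto
    with x show ?thesis by (intro exI[of _ x]) (auto simp: P2_def)
  qed
  \<comment> \<open>For \<open>t\<close> not above \<open>G c0\<close> these values are arbitrary;
    only large \<open>t\<close> matter.\<close>
  define c1 where "c1 t = (SOME c. P1 t c)" for t
  define c2 where "c2 t = (SOME c. P2 t c)" for t
  have c1: "P1 t (c1 t)" and c2: "P2 t (c2 t)" if "t > G c0" for t
    unfolding c1_def c2_def using someI_ex[OF ex1[OF that]] someI_ex[OF ex2[OF that]] by auto
  show thesis
  proof
    show "(c1 \<longlongrightarrow> 0) at_top"
    proof (rule tendstoI)
      fix e :: real assume e: "e > 0"
      \<comment> \<open>Capping by \<open>c0\<close> keeps the comparison on the decreasing
        branch.\<close>
      define \<delta> where "\<delta> = min e c0"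
      have \<delta>: "0 < \<delta>" "\<delta> \<le> c0" "\<delta> \<le> e" using e c0 by (auto simp: \<delta>_def)
      show "\<forall>\<^sub>F t in at_top. dist (c1 t) 0 < e"
        using eventually_gt_at_top[of "G c0"] eventually_gt_at_top[of "G \<delta>"]
      proof eventually_elim
        case (elim t)
        then have "c1 t < \<delta>"
          using c1[of t] dec[of \<delta> "c1 t"] \<delta> unfolding P1_def
          by (cases "c1 t" \<delta> rule: linorder_cases) auto
        then show ?case using c1[of t] elim \<delta> by (simp add: P1_def)
      qed
    qed
    show "filterlim c2 at_top at_top"
      unfolding filterlim_at_top_ge[where c = c0]
    proof (intro allI impI)
      fix Z assume Z: "Z \<ge> c0"
      show "\<forall>\<^sub>F t in at_top. Z \<le> c2 t"
        using eventually_gt_at_top[of "G c0"] eventually_gt_at_top[of "G Z"]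
      proof eventually_elim
        case (elim t)
        then show ?case
          using c2[of t] inc[of "c2 t" Z] unfolding P2_def
          by (cases "c2 t" Z rule: linorder_cases) auto
      qed
    qed
    show "\<forall>\<^sub>F t in at_top. 0 < c1 t \<and> c1 t < c2 t \<and> (\<forall>c>0. G c = t \<longleftrightarrow> c = c1 t \<or> c = c2 t)"
      using eventually_gt_at_top[of "G c0"]
    proof eventually_elim
      case (elim t)
      note P = c1[OF elim, unfolded P1_def] c2[OF elim, unfolded P2_def]
      have "c = c1 t \<or> c = c2 t" if c: "c > 0" "G c = t" for c
      proof (cases "c \<le> c0")
        case True
        then show ?thesis
          using dec[of c "c1 t"] dec[of "c1 t" c] P c
          by (cases c "c1 t" rule: linorder_cases) auto
      next
        case False
        then show ?thesis
          using inc[of c "c2 t"] inc[of "c2 t" c] P c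
          by (cases c "c2 t" rule: linorder_cases) auto
      qed
      then show ?case using P by auto
    qed
  qed
qed

text \<open>Taking logarithms turns the equation into \<open>G c = ln lam\<close>. The derivative of
  \<open>G\<close> has the sign of r A c^p - (p-1) b, which changes once, so
  \<open>two_branches\<close> applies and is composed with \<open>ln\<close>.\<close>

lemma two_roots:
  fixes A b p q :: real
  assumes A: "A > 0" and b: "b > 0" and p: "p > 1" and r: "p * q - p + 1 > 0"
  obtains c1 c2 where "(c1 \<longlongrightarrow> 0) at_top" "filterlim c2 at_top at_top"
    "\<forall>\<^sub>F lam in at_top. 0 < c1 lam \<and> c1 lam < c2 lam \<and>
       (\<forall>c>0. (A * c powr p + b) powr q = lam * c powr (p - 1) \<longleftrightarrow> c = c1 lam \<or> c = c2 lam)"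
proof -
  define r where "r = p * q - p + 1"
  have r0: "r > 0" using r by (simp add: r_def)
  have "p * q > 0" using r p by linarith
  then have q: "q > 0" using p by (simp add: zero_less_mult_iff)
  define G where "G c = q * ln (A * c powr p + b) - (p - 1) * ln c" for c
  \<comment> \<open>The zero of the numerator r A c^p - (p-1) b.\<close>
  define c0 where "c0 = ((p - 1) * b / (r * A)) powr (1 / p)"
  have c0: "c0 > 0" using A b p r0 by (simp add: c0_def)
  have c0p: "r * A * c0 powr p = (p - 1) * b"
    using A b p r0 by (simp add: c0_def powr_powr)
  have pos: "A * c powr p + b > 0" for c
    using A b by (simp add: add_nonneg_pos)
  have G': "(G has_real_derivative (r * A * c powr p - (p - 1) * b) / (c * (A * c powr p + b))) (at c)"
    if c: "c > 0" for c
  proof -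
    have cp: "c powr p = c * c powr (p - 1)" using powr_add[of c 1 "p - 1"] c by simp
    have "(G has_real_derivative q * (A * (p * c powr (p - 1)) / (A * c powr p + b)) - (p - 1) * (1 / c)) (at c)"
      unfolding G_def using pos[of c] c
      by (auto intro!: derivative_eq_intros)
    also have "q * (A * (p * c powr (p - 1)) / (A * c powr p + b)) - (p - 1) * (1 / c)
      = (r * A * c powr p - (p - 1) * b) / (c * (A * c powr p + b))"
    proof -
      have "q * (A * (p * c powr (p - 1)) / (A * c powr p + b)) - (p - 1) * (1 / c)
        = (q * A * p * (c * c powr (p - 1)) - (p - 1) * (A * c powr p + b)) / (c * (A * c powr p + b))"
        using pos[of c] c by (simp add: diff_divide_distrib)
      also have "q * A * p * (c * c powr (p - 1)) - (p - 1) * (A * c powr p + b)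
        = r * A * c powr p - (p - 1) * b"
        unfolding cp[symmetric] r_def by (simp add: algebra_simps)
      finally show ?thesis .
    qed
    finally show ?thesis .
  qed
  have contG: "continuous_on {0<..} G"
    by (rule continuous_at_imp_continuous_on) (use G' DERIV_isCont in force)
  have dec: "G y < G x" if "0 < x" "x < y" "y \<le> c0" for x y
  proof (rule DERIV_neg_imp_decreasing_open[where f = G])
    show "x < y" by fact
    show "continuous_on {x..y} G" using contG that by (auto intro: continuous_on_subset)
    fix z assume z: "x < z" "z < y"
    have "r * A * z powr p < r * A * c0 powr p"
      using z that r0 A p by (intro mult_strict_left_mono powr_less_mono2) auto
    then show "\<exists>e. (G has_real_derivative e) (at z) \<and> e < 0"
      using G'[of z] z that pos[of z] unfolding c0p
      by (intro exI[of _ "(r * A * z powr p - (p - 1) * b) / (z * (A * z powr p + b))"])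
         (auto intro!: divide_neg_pos mult_pos_pos)
  qed
  have inc: "G x < G y" if "c0 \<le> x" "x < y" for x y
  proof (rule DERIV_pos_imp_increasing_open[where f = G])
    show "x < y" by fact
    show "continuous_on {x..y} G" using contG that c0 by (auto intro: continuous_on_subset)
    fix z assume z: "x < z" "z < y"
    have "r * A * c0 powr p < r * A * z powr p"
      using z that r0 A p c0 by (intro mult_strict_left_mono powr_less_mono2) auto
    then show "\<exists>e. (G has_real_derivative e) (at z) \<and> 0 < e"
      using G'[of z] z that pos[of z] c0 unfolding c0p
      by (intro exI[of _ "(r * A * z powr p - (p - 1) * b) / (z * (A * z powr p + b))"])
         (auto intro!: divide_pos_pos mult_pos_pos)
  qed
  have lim0: "filterlim G at_top (at_right 0)"
  proof (rule filterlim_at_top_mono)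
    have "filterlim (\<lambda>c. (p - 1) * (- ln c)) at_top (at_right (0::real))"
      using p ln_at_0 by (intro filterlim_tendsto_pos_mult_at_top[OF tendsto_const])
        (auto simp: filterlim_uminus_at_bot)
    \<comment> \<open>Near 0 the term -(p-1) ln c dominates; the other one is at least q ln
      b.\<close>
    then show "filterlim (\<lambda>c. q * ln b + (p - 1) * (- ln c)) at_top (at_right 0)"
      by (rule filterlim_tendsto_add_at_top[OF tendsto_const])
    show "\<forall>\<^sub>F c in at_right 0. q * ln b + (p - 1) * (- ln c) \<le> G c"
    proof (intro always_eventually allI)
      fix c
      have "ln b \<le> ln (A * c powr p + b)"
        using pos[of c] b A by simp
      then show "q * ln b + (p - 1) * (- ln c) \<le> G c"
        using q by (simp add: G_def)
    qed
  qed
  have lim_top: "filterlim G at_top at_top"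
  proof (rule filterlim_at_top_mono)
    have "filterlim (\<lambda>c. r * ln c) at_top at_top"
      using r0 ln_at_top by (intro filterlim_tendsto_pos_mult_at_top[OF tendsto_const])
    \<comment> \<open>Dropping \<open>b\<close> leaves q ln A + (p q - (p-1)) ln c, whose
      coefficient is r > 0.\<close>
    then show "filterlim (\<lambda>c. q * ln A + r * ln c) at_top at_top"
      by (rule filterlim_tendsto_add_at_top[OF tendsto_const])
    show "\<forall>\<^sub>F c in at_top. q * ln A + r * ln c \<le> G c"
      using eventually_gt_at_top[of 0]
    proof eventually_elim
      case (elim c)
      have "ln (A * c powr p) \<le> ln (A * c powr p + b)"
        using A b elim pos[of c] by (subst ln_le_cancel_iff) auto
      then have "q * ln (A * c powr p) \<le> q * ln (A * c powr p + b)"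
        using q by simp
      then show ?case
        using A elim by (simp add: G_def ln_mult r_def algebra_simps)
    qed
  qed
  obtain c1 c2 where c: "(c1 \<longlongrightarrow> 0) at_top" "filterlim c2 at_top at_top"
    "\<forall>\<^sub>F t in at_top. 0 < c1 t \<and> c1 t < c2 t \<and> (\<forall>c>0. G c = t \<longleftrightarrow> c = c1 t \<or> c = c2 t)"
    using two_branches[OF c0 contG dec inc lim0 lim_top] by blast
  have eq: "(A * c powr p + b) powr q = lam * c powr (p - 1) \<longleftrightarrow> G c = ln lam"
    if "c > 0" "lam > 0" for c lam
  proof -
    have "(A * c powr p + b) powr q = lam * c powr (p - 1) \<longleftrightarrow>
        ln ((A * c powr p + b) powr q) = ln (lam * c powr (p - 1))"
      using that pos[of c] by (intro ln_inj_iff[symmetric]) auto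
    then show ?thesis
      using that by (auto simp: G_def ln_mult)
  qed
  show thesis
  proof (rule that[of "\<lambda>lam. c1 (ln lam)" "\<lambda>lam. c2 (ln lam)"])
    show "((\<lambda>lam. c1 (ln lam)) \<longlongrightarrow> 0) at_top"
      by (rule filterlim_compose[OF c(1) ln_at_top])
    show "filterlim (\<lambda>lam. c2 (ln lam)) at_top at_top"
      by (rule filterlim_compose[OF c(2) ln_at_top])
    show "\<forall>\<^sub>F lam in at_top. 0 < c1 (ln lam) \<and> c1 (ln lam) < c2 (ln lam) \<and>
       (\<forall>c>0. (A * c powr p + b) powr q = lam * c powr (p - 1) \<longleftrightarrow> c = c1 (ln lam) \<or> c = c2 (ln lam))"
      using eventually_compose_filterlim[OF c(3) ln_at_top] eventually_gt_at_top[of 0]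
      by eventually_elim (auto simp: eq)
  qed
qed

section \<open>Exact expansions of the two roots\<close>

definition powr_quot :: "real \<Rightarrow> real \<Rightarrow> real \<Rightarrow> real" where
  "powr_quot a s y = ((1 + y) powr a - 1) / (a * y) * (1 + y) powr s"

text \<open>The first factor of \<open>powr_quot\<close> is the difference quotient of (1+y)^a at 0
  divided by its limit a; the second tends to 1. For y > 0 it is the exact factor 1 + o(1) in
  (1+y)^a = 1 + a y (1+y)^(-s) \<open>powr_quot a s y\<close>, where s allows for y being known only
  up to a power of 1+y.\<close>

lemma powr_quot_tendsto:
  assumes "a \<noteq> 0"
  shows "(powr_quot a s \<longlongrightarrow> 1) (at_right 0)"
proof -
  have "((\<lambda>y. (1 + y) powr a) has_real_derivative a) (at 0)"
    by (auto intro!: derivative_eq_intros)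
  then have "((\<lambda>y. ((1 + y) powr a - 1) / y) \<longlongrightarrow> a) (at_right 0)"
    by (auto simp: DERIV_def intro: filterlim_mono[OF _ order_refl at_le])
  then have "((\<lambda>y. ((1 + y) powr a - 1) / y / a * (1 + y) powr s) \<longlongrightarrow> a / a * (1 + 0) powr s) (at_right 0)"
    by (intro tendsto_intros) (use assms in auto)
  then show ?thesis
    using assms unfolding powr_quot_def[abs_def] by (simp add: mult.commute)
qed

text \<open>Factoring b out of the sum gives c = B (1+y)^\<alpha> with B the leading term. The
  stated correction involves lam, hence B, in place of c, and B^p = c^p (1+y)^(-\<alpha> p) accounts
  for the second parameter of \<open>powr_quot\<close>. The identity is exact; no limit is
  taken.\<close>

lemma small_root_expansion:
  fixes A b c lam p q :: real
  assumes A: "A > 0" and b: "b > 0" and p: "p > 1" and q: "q > 0"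
    and c: "c > 0" and lam: "lam > 0"
    and eq: "(A * c powr p + b) powr q = lam * c powr (p - 1)"
    and y: "y = A * c powr p / b"
  shows "c = b powr (q / (p - 1)) * lam powr (- 1 / (p - 1))
     * (1 + q / (p - 1) * b powr ((p * q - p + 1) / (p - 1)) * A * lam powr (- p / (p - 1))
          * powr_quot (q / (p - 1)) (q / (p - 1) * p) y)"
proof -
  define \<alpha> where "\<alpha> = q / (p - 1)"
  have \<alpha>: "\<alpha> > 0" using p q by (simp add: \<alpha>_def)
  have y0: "y > 0" using A b c by (simp add: y)
  define B where "B = b powr \<alpha> * lam powr (- 1 / (p - 1))"
  have B0: "B > 0" using b lam by (simp add: B_def)
  have cB: "c = B * (1 + y) powr \<alpha>"
  proof -
    have "(b * (1 + y)) powr q = lam * c powr (p - 1)"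
      using eq b by (simp add: y distrib_left add.commute)
    then have "ln ((b * (1 + y)) powr q) = ln (lam * c powr (p - 1))" by simp
    then have "q * (ln b + ln (1 + y)) = ln lam + (p - 1) * ln c"
      using b y0 lam c by (simp add: ln_mult)
    then have "(p - 1) * ln c = q * ln b - ln lam + q * ln (1 + y)"
      by (simp add: algebra_simps)
    then have "ln c = (q * ln b - ln lam + q * ln (1 + y)) / (p - 1)"
      using p by (simp add: eq_divide_eq mult.commute)
    then have "ln c = \<alpha> * ln b - 1 / (p - 1) * ln lam + \<alpha> * ln (1 + y)"
      by (simp add: \<alpha>_def add_divide_distrib diff_divide_distrib)
    also have "\<dots> = ln (B * (1 + y) powr \<alpha>)"
      using b y0 lam by (simp add: B_def ln_mult)
    finally show ?thesis using c B0 y0 by simp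
  qed
  \<comment> \<open>The powers of b and lam in the correction combine to B^p / b, so its coefficient
    is \<alpha> A B^p / b = \<alpha> y (1+y)^(-\<alpha> p).\<close>
  have "b powr ((p * q - p + 1) / (p - 1)) = b powr (\<alpha> * p - 1)"
    using p by (intro arg_cong[where f = "\<lambda>t. b powr t"]) (simp add: \<alpha>_def field_simps)
  also have "\<dots> = (b powr \<alpha>) powr p / b"
    using b by (simp add: powr_diff powr_powr)
  finally have "b powr ((p * q - p + 1) / (p - 1)) * lam powr (- p / (p - 1)) = B powr p / b"
    using b lam by (simp add: B_def powr_mult powr_powr)
  moreover have "B powr p = c powr p * (1 + y) powr (- (\<alpha> * p))"
    unfolding cB using B0 y0 by (simp add: powr_mult powr_powr powr_minus)
  ultimately have "\<alpha> * b powr ((p * q - p + 1) / (p - 1)) * A * lam powr (- p / (p - 1))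
      = \<alpha> * y * (1 + y) powr (- (\<alpha> * p))"
    using b by (simp add: y field_simps)
  then have "1 + \<alpha> * b powr ((p * q - p + 1) / (p - 1)) * A * lam powr (- p / (p - 1)) * powr_quot \<alpha> (\<alpha> * p) y
      = 1 + \<alpha> * y * (1 + y) powr (- (\<alpha> * p)) * powr_quot \<alpha> (\<alpha> * p) y"
    by (simp only:)
  also have "\<dots> = (1 + y) powr \<alpha>"
    using \<alpha> y0 by (simp add: powr_quot_def powr_minus field_simps)
  finally show ?thesis
    using cB unfolding B_def \<alpha>_def[symmetric] by simp
qed

text \<open>Here N^p c^p is the dominant summand and is factored out, which gives c N = D
  (1+y)^(-\<beta>) with D the leading term. The negative exponent produces the minus sign of the
  correction D (1 - (1+y)^(-\<beta>)).\<close>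

lemma large_root_expansion:
  fixes N b c lam p q m :: real
  assumes N: "N > 0" and b: "b > 0" and q: "q > 0" and r: "p * q - p + 1 > 0"
    and c: "c > 0" and lam: "lam > 0"
    and eq: "(N powr p * c powr p + b) powr q = lam * c powr (p - 1)"
    and m: "m = N powr ((1 - p) / (p * q - p + 1))"
    and y: "y = b / (N powr p * c powr p)"
  shows "c * N = m * lam powr (1 / (p * q - p + 1))
     - b * q * m powr (1 - p) / (p * q - p + 1) * lam powr ((1 - p) / (p * q - p + 1))
       * powr_quot (- (q / (p * q - p + 1))) (q / (p * q - p + 1) * p) y"
proof -
  define r where "r = p * q - p + 1"
  define \<beta> where "\<beta> = q / r"
  have r0: "r > 0" using r by (simp add: r_def)
  have \<beta>: "\<beta> > 0" using q r0 by (simp add: \<beta>_def)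
  have y0: "y > 0" using N b c by (simp add: y)
  have m0: "m > 0" using N by (simp add: m)
  define D where "D = m * lam powr (1 / r)"
  have D0: "D > 0" using m0 lam by (simp add: D_def)
  have cD: "c * N = D * (1 + y) powr (- \<beta>)"
  proof -
    have "(N powr p * c powr p * (1 + y)) powr q = lam * c powr (p - 1)"
      using eq N c by (simp add: y distrib_left)
    then have "ln ((N powr p * c powr p * (1 + y)) powr q) = ln (lam * c powr (p - 1))" by simp
    then have *: "q * (p * ln N + p * ln c + ln (1 + y)) = ln lam + (p - 1) * ln c"
      using N y0 lam c by (simp add: ln_mult)
    \<comment> \<open>Adding (1-p) ln N to both sides gives ln N the same coefficient r = p q - p +
      1 as ln c.\<close>
    have "r * (ln c + ln N) = ln lam + (1 - p) * ln N - q * ln (1 + y)"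
      using * by (simp add: r_def algebra_simps)
    then have "ln c + ln N = (ln lam + (1 - p) * ln N - q * ln (1 + y)) / r"
      using r0 by (simp add: field_simps)
    then have "ln (c * N) = (1 - p) / r * ln N + 1 / r * ln lam - \<beta> * ln (1 + y)"
      using c N by (simp add: ln_mult \<beta>_def add_divide_distrib diff_divide_distrib left_diff_distrib)
    also have "\<dots> = ln (D * (1 + y) powr (- \<beta>))"
      using m0 y0 lam by (simp add: D_def ln_mult m r_def)
    finally show ?thesis using c N D0 y0 by simp
  qed
  \<comment> \<open>The correction has size D^(1-p) = D D^(-p), and D^(-p) is y/b up to the power of
    1+y absorbed by \<open>powr_quot\<close>.\<close>
  have "m powr (1 - p) * lam powr ((1 - p) / r) = D powr (1 - p)"
    using m0 lam by (simp add: D_def powr_mult powr_powr)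
  also have "\<dots> = D * D powr (- p)"
    using powr_add[of D 1 "- p"] D0 by simp
  also have "D powr (- p) = (c * N) powr (- p) * (1 + y) powr (- (\<beta> * p))"
    unfolding cD using D0 y0 by (simp add: powr_mult powr_powr powr_add[symmetric])
  also have "(c * N) powr (- p) = y / b"
    using c N b by (simp add: y powr_mult powr_minus_divide mult.commute)
  finally have "b * q * m powr (1 - p) / r * lam powr ((1 - p) / r) = D * \<beta> * y * (1 + y) powr (- (\<beta> * p))"
    using b by (simp add: \<beta>_def)
  then have "b * q * m powr (1 - p) / r * lam powr ((1 - p) / r) * powr_quot (- \<beta>) (\<beta> * p) y
      = D * \<beta> * y * (1 + y) powr (- (\<beta> * p)) * powr_quot (- \<beta>) (\<beta> * p) y"
    by (simp only:)
  also have "\<dots> = D * (1 - (1 + y) powr (- \<beta>))"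
    using \<beta> y0 by (simp add: powr_quot_def powr_minus field_simps)
  finally show ?thesis
    using cD unfolding D_def \<beta>_def r_def by (simp add: right_diff_distrib)
qed

section \<open>Counting and expansion of the solutions\<close>

text \<open>Each o(1) is one function of \<open>lam\<close> chosen before x, so the expansions are
  uniform in x. The two solutions are the multiples of \<open>W p\<close> by the two roots.\<close>

theorem theorem1p4:
  fixes b p q m :: real
  assumes "b > 0" and "p > 1" and "q > 1 - 1 / p"
    and "m = Lp_norm p (W p) powr ((1 - p) / (p * q - p + 1))"
  shows "\<exists>(u1 :: real \<Rightarrow> real \<Rightarrow> real) (u2 :: real \<Rightarrow> real \<Rightarrow> real)
          (\<epsilon>1 :: real \<Rightarrow> real) (\<epsilon>2 :: real \<Rightarrow> real).
      (\<epsilon>1 \<longlongrightarrow> 0) at_top \<and> (\<epsilon>2 \<longlongrightarrow> 0) at_top \<and>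
      (\<forall>\<^sub>F lam in at_top.
         {u. solution b p q lam u} = {u1 lam, u2 lam} \<and> u1 lam \<noteq> u2 lam \<and>
         (\<forall>x\<in>{0..1}.
            u1 lam x = b powr (q / (p - 1)) * lam powr (- 1 / (p - 1))
              * (1 + q / (p - 1) * b powr ((p * q - p + 1) / (p - 1)) * Lp_norm p (W p) powr p
                     * lam powr (- p / (p - 1)) * (1 + \<epsilon>1 lam))
              * W p x) \<and>
         (\<forall>x\<in>{0..1}.
            u2 lam x = (m * lam powr (1 / (p * q - p + 1))
                - b * q * m powr (1 - p) / (p * q - p + 1)
                    * lam powr ((1 - p) / (p * q - p + 1)) * (1 + \<epsilon>2 lam))
              * inverse (Lp_norm p (W p)) * W p x))"
proof -
  define N where "N = Lp_norm p (W p)"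
  define A where "A = N powr p"
  have b: "b > 0" and p: "p > 1" by fact+
  have N: "N > 0" using Lp_norm_W(1)[OF p] by (simp add: N_def)
  have A: "A > 0" using N by (simp add: A_def)
  \<comment> \<open>The hypothesis on q multiplied by p.\<close>
  have r: "p * q - p + 1 > 0"
    using mult_strict_left_mono[OF assms(3), of p] p by (simp add: right_diff_distrib)
  have q: "q > 0"
    using assms(3) p by (smt (verit) divide_le_eq_1)
  obtain c1 c2 where c: "(c1 \<longlongrightarrow> 0) at_top" "filterlim c2 at_top at_top"
    "\<forall>\<^sub>F lam in at_top. 0 < c1 lam \<and> c1 lam < c2 lam \<and>
       (\<forall>c>0. (A * c powr p + b) powr q = lam * c powr (p - 1) \<longleftrightarrow> c = c1 lam \<or> c = c2 lam)"
    using two_roots[OF A b p r] by blast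
  define u where "u c = restrict (\<lambda>x. c * W p x) {0..1}" for c
  define y1 where "y1 lam = A * c1 lam powr p / b" for lam
  define y2 where "y2 lam = b / (A * c2 lam powr p)" for lam
  define \<epsilon>1 where "\<epsilon>1 lam = powr_quot (q / (p - 1)) (q / (p - 1) * p) (y1 lam) - 1" for lam
  define \<epsilon>2 where "\<epsilon>2 lam = powr_quot (- (q / (p * q - p + 1))) (q / (p * q - p + 1) * p) (y2 lam) - 1"
    for lam
  have c_pos: "\<forall>\<^sub>F lam in at_top. 0 < c1 lam" "\<forall>\<^sub>F lam in at_top. 0 < c2 lam"
    using c(3) by (auto elim!: eventually_mono)
  \<comment> \<open>The limit of \<open>powr_quot\<close> is one-sided, so y1 must tend to 0 through
    positive values; likewise y2 below.\<close>
  have "filterlim y1 (at_right 0) at_top"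
    unfolding filterlim_at
  proof
    have "((\<lambda>lam. c1 lam powr p) \<longlongrightarrow> 0 powr p) at_top"
      by (rule tendsto_powr'[OF c(1) tendsto_const]) (use p c_pos(1) in \<open>auto elim: eventually_mono\<close>)
    then have "((\<lambda>lam. A * c1 lam powr p / b) \<longlongrightarrow> A * 0 powr p / b) at_top"
      by (intro tendsto_divide tendsto_mult tendsto_const) (use b in auto)
    then show "(y1 \<longlongrightarrow> 0) at_top" by (simp add: y1_def[abs_def])
    show "\<forall>\<^sub>F lam in at_top. y1 lam \<in> {0<..} \<and> y1 lam \<noteq> 0"
      using c_pos(1) by eventually_elim (use A b in \<open>simp add: y1_def\<close>)
  qed
  then have "((\<lambda>lam. powr_quot (q / (p - 1)) (q / (p - 1) * p) (y1 lam)) \<longlongrightarrow> 1) at_top"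
    by (rule filterlim_compose[OF powr_quot_tendsto, rotated]) (use p q in simp)
  then have lim1: "(\<epsilon>1 \<longlongrightarrow> 0) at_top"
    unfolding \<epsilon>1_def by (simp add: LIM_zero)
  have "filterlim y2 (at_right 0) at_top"
    unfolding filterlim_at
  proof
    have "((\<lambda>lam. b / A * c2 lam powr (- p)) \<longlongrightarrow> b / A * 0) at_top"
      using p by (intro tendsto_mult tendsto_const tendsto_neg_powr c(2)) auto
    then show "(y2 \<longlongrightarrow> 0) at_top" by (simp add: y2_def[abs_def] powr_minus_divide)
    show "\<forall>\<^sub>F lam in at_top. y2 lam \<in> {0<..} \<and> y2 lam \<noteq> 0"
      using c_pos(2) by eventually_elim (use A b in \<open>simp add: y2_def\<close>)
  qed
  then have "((\<lambda>lam. powr_quot (- (q / (p * q - p + 1))) (q / (p * q - p + 1) * p) (y2 lam)) \<longlongrightarrow> 1) at_top"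
    by (rule filterlim_compose[OF powr_quot_tendsto, rotated]) (use r q in simp)
  then have lim2: "(\<epsilon>2 \<longlongrightarrow> 0) at_top"
    unfolding \<epsilon>2_def by (simp add: LIM_zero)
  have W_half: "W p (1/2) > 0"
    using W_profile[OF p] by (auto simp: profile_def)
  have "\<forall>\<^sub>F lam in at_top.
         {v. solution b p q lam v} = {u (c1 lam), u (c2 lam)} \<and> u (c1 lam) \<noteq> u (c2 lam) \<and>
         (\<forall>x\<in>{0..1}.
            u (c1 lam) x = b powr (q / (p - 1)) * lam powr (- 1 / (p - 1))
              * (1 + q / (p - 1) * b powr ((p * q - p + 1) / (p - 1)) * N powr p
                     * lam powr (- p / (p - 1)) * (1 + \<epsilon>1 lam))
              * W p x) \<and>
         (\<forall>x\<in>{0..1}.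
            u (c2 lam) x = (m * lam powr (1 / (p * q - p + 1))
                - b * q * m powr (1 - p) / (p * q - p + 1)
                    * lam powr ((1 - p) / (p * q - p + 1)) * (1 + \<epsilon>2 lam))
              * inverse N * W p x)"
    using c(3) eventually_gt_at_top[of 0]
  proof eventually_elim
    case (elim lam)
    then have pos: "c1 lam > 0" "c2 lam > 0" "lam > 0" and less: "c1 lam < c2 lam"
      and roots: "\<And>c. c > 0 \<Longrightarrow>
        (A * c powr p + b) powr q = lam * c powr (p - 1) \<longleftrightarrow> c = c1 lam \<or> c = c2 lam"
      by auto
    have "solution b p q lam v \<longleftrightarrow> (\<exists>c>0. (c = c1 lam \<or> c = c2 lam) \<and> v = u c)" for v
      unfolding solution_iff[OF b p \<open>lam > 0\<close>] N_def[symmetric] A_def[symmetric] u_def[symmetric]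
      using roots by metis
    then have set: "{v. solution b p q lam v} = {u (c1 lam), u (c2 lam)}"
      using pos by auto
    \<comment> \<open>Different roots give different functions because \<open>W p\<close> is
      positive at the midpoint.\<close>
    have "u (c1 lam) (1/2) < u (c2 lam) (1/2)"
      using less W_half by (simp add: u_def)
    then have ne: "u (c1 lam) \<noteq> u (c2 lam)" by auto
    have e1: "c1 lam = b powr (q / (p - 1)) * lam powr (- 1 / (p - 1))
              * (1 + q / (p - 1) * b powr ((p * q - p + 1) / (p - 1)) * N powr p
                     * lam powr (- p / (p - 1)) * (1 + \<epsilon>1 lam))"
      using small_root_expansion[OF A b p q pos(1,3) _ y1_def] roots[OF pos(1)]
      by (simp add: \<epsilon>1_def A_def)
    have "c2 lam * N = m * lam powr (1 / (p * q - p + 1))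
                - b * q * m powr (1 - p) / (p * q - p + 1)
                    * lam powr ((1 - p) / (p * q - p + 1)) * (1 + \<epsilon>2 lam)"
      using large_root_expansion[OF N b q r pos(2,3) _ assms(4)[folded N_def]
          y2_def[of lam, unfolded A_def]] roots[OF pos(2)]
      by (simp add: \<epsilon>2_def A_def)
    then have e2: "c2 lam = (m * lam powr (1 / (p * q - p + 1))
                - b * q * m powr (1 - p) / (p * q - p + 1)
                    * lam powr ((1 - p) / (p * q - p + 1)) * (1 + \<epsilon>2 lam)) * inverse N"
      using N by (metis less_irrefl mult.assoc mult.right_neutral right_inverse)
    show ?case
      using set ne e1 e2 by (simp add: u_def)
  qed
  then show ?thesis
    unfolding N_def[symmetric] using lim1 lim2
    by (intro exI[of _ "\<lambda>lam. u (c1 lam)"] exI[of _ "\<lambda>lam. u (c2 lam)"] exI[of _ \<epsilon>1] exI[of _ \<epsilon>2]) blast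
qed

end
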